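(* Let $C=\{(p_1,q_1),\ldots,(p_n,q_n)\}$ be a menu such that every pair in it has positive demand, labeled so that $p_1<\cdots<p_n$, and let $C'=\{(p_n',q_n)\}$ be a menu consisting of a single pair, with positive demand, where $p_n'\ge p_n$. Assume that $m(1-F(m))$ is strictly quasi-concave on $[a,b]$ and that $p^M(1)\in(a,b)$. Then: (1) $\pi(C)\le\pi(C')$ if $p_n'/q_n\le p^M(1)$ and $F(m)m$ is convex on $[m_1(C),m_n(C)]$. (2) $\pi(C)\ge\pi(C')$ if $m_n(C)\ge p^M(1)$ and $F(m)m$ is concave on $[m_1(C),m_n(C)]$.
   Context: Buyers' types $m$ are distributed according to a continuous cumulative distribution function $F$ (on $\mathbb{R}$) supported on an interval $[a,b]\subseteq[0,\infty)$, $a<b$ (so $F$ is strictly increasing on $[a,b]$, $F(a)=0$, $F(b)=1$), with a density $f$ that is continuous on $[a,b]$. A menu is a finite nonempty set $C=\{(p_1,q_1),\ldots,(p_n,q_n)\}$ of distinct price-quality pairs with $p_i\ge 0$, $q_i>0$. A type $m$ buyer gets utility $mq-p$ from the pair $(p,q)$ and $0$ from not buying. The demand for $(p_i,q_i)$ is $$D_i(C)=\int_a^b 1\{mq_i-p_i\ge 0\}\,1\{mq_i-p_i=\max_{(p_j,q_j)\in C}(mq_j-p_j)\}\,F(dm)$$ (ties have mass zero), and the total transaction value (revenue) is $\pi(C)=\sum_{(p_i,q_i)\in C}p_iD_i(C)$. For a menu $C=\{(p_1,q_1),\ldots,(p_n,q_n)\}$ all of whose pairs have positive demand, labeled with increasing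 prices (then qualities are increasing as well), define $m_i(C)=(p_i-p_{i-1})/(q_i-q_{i-1})$ for $i=1,\ldots,n$, where $p_0=q_0=0$. Further, $p^M(1)=\operatorname{argmax}_{p\ge0}\,p(1-F(p))$ is the monopoly price at quality $1$, which is unique under the strict quasi-concavity assumption. *)

theory Defs
  imports "HOL-Probability.Probability"
begin

text \<open>
  A price-quality pair is \<open>(p, q)\<close>.  The measure \<open>M\<close> is the distribution of buyers' types; its
  cumulative distribution function is \<open>cdf M\<close>.  Since a menu is a set, its pairs are distinct.
\<close>

definition is_menu :: "(real \<times> real) set \<Rightarrow> bool" where
  "is_menu C \<longleftrightarrow> finite C \<and> C \<noteq> {} \<and> (\<forall>(p, q)\<in>C. 0 \<le> p \<and> 0 < q)"

definition demand ::
  "real measure \<Rightarrow> real \<Rightarrow> real \<Rightarrow> (real \<times> real) set \<Rightarrow> real \<times> real \<Rightarrow> real" where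
  "demand M a b C = (\<lambda>(p, q). LINT m:{a..b}|M.
     indicator {m. m * q - p \<ge> 0} m *
     indicator {m. m * q - p = Max ((\<lambda>(p', q'). m * q' - p') ` C)} m)"

definition revenue :: "real measure \<Rightarrow> real \<Rightarrow> real \<Rightarrow> (real \<times> real) set \<Rightarrow> real" where
  "revenue M a b C = (\<Sum>(p, q)\<in>C. p * demand M a b C (p, q))"

text \<open>
  For pairs labeled \<open>(p i, q i)\<close> with \<open>i = 1, ..., n\<close>; the value at \<open>i = 1\<close> is the intended one
  only under the convention \<open>p 0 = q 0 = 0\<close>.
\<close>

definition cutoff :: "(nat \<Rightarrow> real) \<Rightarrow> (nat \<Rightarrow> real) \<Rightarrow> nat \<Rightarrow> real" where
  "cutoff p q i = (p i - p (i - 1)) / (q i - q (i - 1))"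

text \<open>The monopoly price at quality 1.\<close>

definition monopoly_price :: "real measure \<Rightarrow> real" where
  "monopoly_price M = (ARG_MAX (\<lambda>p. p * (1 - cdf M p)) p. 0 \<le> p)"

definition strictly_quasiconcave_on :: "real set \<Rightarrow> (real \<Rightarrow> real) \<Rightarrow> bool" where
  "strictly_quasiconcave_on S g \<longleftrightarrow> convex S \<and>
     (\<forall>x\<in>S. \<forall>y\<in>S. \<forall>t. x \<noteq> y \<longrightarrow> 0 < t \<longrightarrow> t < 1 \<longrightarrow>
        min (g x) (g y) < g ((1 - t) * x + t * y))"

end

theory Submission
  imports Defs
begin

text \<open>
  Put \<open>R m = m (1 - F m)\<close> and let \<open>c i\<close> be the cutoffs.  Type \<open>m\<close> buys pair \<open>i\<close> exactly when
  \<open>c i \<le> m \<le> c (i + 1)\<close>, so Abel summation gives \<open>\<pi>(C) = (\<Sum>i. (q i - q (i - 1)) R (c i))\<close>, while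
  \<open>\<pi>(C') = q n R (p' / q n)\<close>.  The weights \<open>(q i - q (i - 1)) / q n\<close> average the cutoffs to
  \<open>p n / q n\<close>, so Jensen's inequality compares \<open>\<pi>(C)\<close> with \<open>q n R (p n / q n)\<close>, and
  \<open>R\<close> is increasing up to the monopoly price \<open>P\<close> and decreasing from there on.  In the second part
  \<open>P \<le> c 1 \<le> p n / q n\<close> must hold: otherwise \<open>R\<close> would be convex on \<open>[c 1, P]\<close> with \<open>R (c 1) < R P\<close>, which
  is incompatible with \<open>R' P = 0\<close>.
\<close>

section \<open>Interval measures under the distribution of types\<close>

locale type_distribution = real_distribution M for M :: "real measure" +
  fixes a b :: real
  assumes a_nonneg: "0 \<le> a" and a_less_b: "a < b"
    and cont_cdf: "continuous_on UNIV (cdf M)"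
    and cdf_a: "cdf M a = 0" and cdf_b: "cdf M b = 1"
begin

lemma cdf_below: "m \<le> a \<Longrightarrow> cdf M m = 0"
  using cdf_nondecreasing[of m a] cdf_nonneg[of m] cdf_a by simp

lemma cdf_above: "b \<le> m \<Longrightarrow> cdf M m = 1"
  using cdf_nondecreasing[of b m] cdf_bounded_prob[of m] cdf_b by simp

text \<open>\<open>{a<..b}\<close> already has mass \<open>cdf M b - cdf M a = 1\<close>. This
  removes the restriction to \<open>{a..b}\<close> that the integral in \<open>demand\<close>
  carries.\<close>

lemma measure_Int_support:
  assumes "S \<in> sets borel"
  shows "measure M ({a..b} \<inter> S) = measure M S"
proof -
  have "measure M {a<..b} = 1"
    using cdf_diff_eq[OF a_less_b] cdf_a cdf_b by simp
  moreover have "measure M {a<..b} \<le> measure M {a..b}"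
    by (rule finite_measure_mono) auto
  ultimately have "prob {a..b} = 1"
    using prob_le_1[of "{a..b}"] by linarith
  then have "AE m in M. m \<in> {a..b}"
    by (subst (asm) prob_eq_1) auto
  then show ?thesis
    by (intro finite_measure_eq_AE) (use assms in auto)
qed

lemma measure_singleton_eq_0: "measure M {x} = 0"
  using cont_cdf isCont_cdf[of x] by (simp add: continuous_on_eq_continuous_at)

lemma measure_atLeastAtMost:
  assumes "x \<le> y"
  shows "measure M {x..y} = cdf M y - cdf M x"
proof (cases "x = y")
  case True
  then show ?thesis by (simp add: measure_singleton_eq_0)
next
  case False
  then have "x < y" using assms by simp
  have "measure M ({x} \<union> {x<..y}) = measure M {x} + measure M {x<..y}"
    by (rule finite_measure_Union) auto
  moreover have "{x} \<union> {x<..y} = {x..y}" using assms by auto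
  ultimately show ?thesis
    using measure_singleton_eq_0[of x] cdf_diff_eq[OF \<open>x < y\<close>] by simp
qed

lemma measure_atLeast: "measure M {x..} = 1 - cdf M x"
proof -
  have "measure M {x..} = measure M ({a..b} \<inter> {x..})"
    by (rule measure_Int_support[symmetric]) auto
  \<comment> \<open>The right end \<open>max b x\<close> keeps the interval nonempty even for
    \<open>x > b\<close> and lies where the cdf is 1.\<close>
  also have "{a..b} \<inter> {x..} = {a..b} \<inter> {x..max b x}"
    by auto
  also have "measure M \<dots> = measure M {x..max b x}"
    by (rule measure_Int_support) auto
  also have "\<dots> = 1 - cdf M x"
    by (simp add: measure_atLeastAtMost cdf_above)
  finally show ?thesis .
qed

section \<open>Unit-quality revenue on either side of the monopoly price\<close>

definition R :: "real \<Rightarrow> real" where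
  "R m = m * (1 - cdf M m)"

lemma continuous_on_R: "continuous_on S R"
  unfolding R_def
  by (intro continuous_intros continuous_on_subset[OF cont_cdf]) auto

lemma R_below: "m \<le> a \<Longrightarrow> R m = m"
  by (simp add: R_def cdf_below)

lemma R_above: "b \<le> m \<Longrightarrow> R m = 0"
  by (simp add: R_def cdf_above)

lemma R_nonneg: "0 \<le> m \<Longrightarrow> 0 \<le> R m"
  by (simp add: R_def cdf_bounded_prob)

text \<open>\<open>ARG_MAX\<close> is a choice, so a maximizer has to be exhibited first. Continuity
  gives one on \<open>{a..b}\<close>, and it beats every nonnegative price because \<open>R\<close>
  is the identity below \<open>a\<close> and zero above \<open>b\<close>.\<close>

lemma R_le_monopoly:
  assumes "0 \<le> x"
  shows "R x \<le> R (monopoly_price M)"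
proof -
  obtain z where z: "z \<in> {a..b}" "\<And>y. y \<in> {a..b} \<Longrightarrow> R y \<le> R z"
    using continuous_attains_sup[of "{a..b}" R] continuous_on_R a_less_b by force
  have zmax: "R y \<le> R z" if "0 \<le> y" for y
  proof -
    consider "y < a" | "y \<in> {a..b}" | "b < y" by fastforce
    then show ?thesis
    proof cases
      case 1
      then show ?thesis using z(2)[of a] a_less_b R_below[of y] R_below[of a] by simp
    next
      case 2
      then show ?thesis by (rule z(2))
    next
      case 3
      then show ?thesis using R_above[of y] R_nonneg[of z] z(1) a_nonneg by simp
    qed
  qed
  have "R (monopoly_price M) = R z"
    unfolding monopoly_price_def R_def[symmetric]
    by (rule arg_max_equality) (use z(1) a_nonneg zmax in auto)
  with zmax[OF assms] show ?thesis by simp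
qed

lemma R_between:
  assumes "strictly_quasiconcave_on {a..b} R"
    and "a \<le> x" "x < y" "y < z" "z \<le> b"
  shows "min (R x) (R z) < R y"
proof -
  define t where "t = (y - x) / (z - x)"
  have "0 < t" "t < 1" using assms by (auto simp: t_def divide_simps)
  moreover have "(1 - t) * x + t * z = x + t * (z - x)"
    by (simp add: algebra_simps)
  then have "(1 - t) * x + t * z = y"
    using assms by (simp add: t_def)
  moreover have "x \<in> {a..b}" "z \<in> {a..b}" "x \<noteq> z" using assms by auto
  ultimately show ?thesis
    using assms(1) unfolding strictly_quasiconcave_on_def by metis
qed

text \<open>If \<open>R x\<close> were the maximal value as well, strict quasi-concavity would push
  \<open>R\<close> above it at the midpoint. Below \<open>a\<close> the comparison goes through
  \<open>R a = a\<close>.\<close>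

lemma R_less_monopoly:
  assumes sqc: "strictly_quasiconcave_on {a..b} R" and P: "monopoly_price M \<in> {a<..<b}"
    and "0 \<le> x" "x < monopoly_price M"
  shows "R x < R (monopoly_price M)"
proof (cases "x < a")
  case True
  then show ?thesis
    using R_below[of x] R_below[of a] R_le_monopoly[of a] a_nonneg by simp
next
  case False
  define y where "y = (x + monopoly_price M) / 2"
  have "x < y" "y < monopoly_price M" "0 \<le> y"
    using assms by (auto simp: y_def)
  then have "min (R x) (R (monopoly_price M)) < R y"
    using R_between[OF sqc, of x y "monopoly_price M"] False P by simp
  then show ?thesis
    using R_le_monopoly[of y] \<open>0 \<le> y\<close> by linarith
qed

lemma R_mono:
  assumes sqc: "strictly_quasiconcave_on {a..b} R" and P: "monopoly_price M \<in> {a<..<b}"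
    and "0 \<le> x" "x \<le> y" "y \<le> monopoly_price M"
  shows "R x \<le> R y"
proof -
  consider "y \<le> a" | "x = y" | "y = monopoly_price M" | "a < y" "x < y" "y < monopoly_price M"
    using assms by fastforce
  then show ?thesis
  proof cases
    case 1
    then show ?thesis using R_below[of x] R_below[of y] assms by simp
  next
    case 2
    then show ?thesis by simp
  next
    case 3
    then show ?thesis using R_le_monopoly[of x] assms by simp
  next
    case 4
    \<comment> \<open>No value exceeds the one at the monopoly price, so the smaller endpoint value
      is \<open>R (max a x)\<close>. The \<open>max\<close> moves \<open>x\<close> into
      \<open>{a..b}\<close>, where quasi-concavity applies.\<close>
    have "R (max a x) < R y"
      using R_between[OF sqc, of "max a x" y "monopoly_price M"] R_le_monopoly[of "max a x"]
        R_le_monopoly[of y] a_nonneg 4 P by auto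
    moreover have "R x \<le> R (max a x)"
      using R_below[of x] R_below[of a] by (simp add: max_def)
    ultimately show ?thesis by linarith
  qed
qed

lemma R_antimono:
  assumes sqc: "strictly_quasiconcave_on {a..b} R" and P: "monopoly_price M \<in> {a<..<b}"
    and "monopoly_price M \<le> x" "x \<le> y"
  shows "R y \<le> R x"
proof -
  consider "b \<le> y" | "x = y" | "x = monopoly_price M" | "y < b" "x < y" "monopoly_price M < x"
    using assms by fastforce
  then show ?thesis
  proof cases
    case 1
    then show ?thesis using R_above[of y] R_nonneg[of x] assms a_nonneg by simp
  next
    case 2
    then show ?thesis by simp
  next
    case 3
    then show ?thesis using R_le_monopoly[of y] assms a_nonneg by simp
  next
    case 4
    then show ?thesis
      using R_between[OF sqc, of "monopoly_price M" x y] R_le_monopoly[of y] a_nonneg P by auto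
  qed
qed

section \<open>First-order condition at the monopoly price\<close>

text \<open>Fundamental theorem of calculus for the integral of the density from \<open>a\<close>.
  It yields a derivative within \<open>{a..b}\<close>, which is a full derivative at interior
  points.\<close>

lemma cdf_has_derivative:
  assumes M: "M = density lborel (\<lambda>m. ennreal (f m))"
    and f: "f \<in> borel_measurable borel" "\<And>m. 0 \<le> f m" "continuous_on {a..b} f"
    and x: "x \<in> {a<..<b}"
  shows "(cdf M has_real_derivative f x) (at x)"
proof -
  have eq: "cdf M y = integral {a..y} f" if y: "y \<in> {a..b}" for y
  proof -
    have "f integrable_on {a..y}"
      by (rule integrable_continuous_real) (use f(3) y in \<open>auto intro: continuous_on_subset\<close>)
    then have int: "(f has_integral integral {a..y} f) {a..y}"
      by (rule integrable_integral)
    have "emeasure M {a..y} = (\<integral>\<^sup>+m. ennreal (f m) * indicator {a..y} m \<partial>lborel)"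
      by (subst M, subst emeasure_density) (use f(1) in auto)
    also have "\<dots> = (\<integral>\<^sup>+m. ennreal (indicator {a..y} m * f m) \<partial>lborel)"
      by (intro nn_integral_cong) (auto split: split_indicator)
    also have "\<dots> = ennreal (integral {a..y} f)"
      by (rule nn_integral_has_integral_lebesgue[OF _ int]) (rule f(2))
    finally have "measure M {a..y} = integral {a..y} f"
      using f(2) by (simp add: measure_def integral_nonneg has_integral_integrable[OF int])
    then show ?thesis
      using measure_atLeastAtMost[of a y] y cdf_a by simp
  qed
  have "((\<lambda>y. integral {a..y} f) has_real_derivative f x) (at x within {a..b})"
    by (rule integral_has_real_derivative[OF f(3)]) (use x in auto)
  then have "(cdf M has_real_derivative f x) (at x within {a..b})"
    by (rule has_field_derivative_transform_within[where d = 1]) (use x eq in auto)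
  moreover have "at x within {a..b} = at x"
    by (rule at_within_interior) (use x in simp)
  ultimately show ?thesis by simp
qed

lemma R_has_derivative_0_monopoly:
  assumes "M = density lborel (\<lambda>m. ennreal (f m))"
    and "f \<in> borel_measurable borel" "\<And>m. 0 \<le> f m" "continuous_on {a..b} f"
    and P: "monopoly_price M \<in> {a<..<b}"
  shows "(R has_real_derivative 0) (at (monopoly_price M))"
proof -
  let ?P = "monopoly_price M"
  have "\<exists>l. (R has_real_derivative l) (at ?P)"
    unfolding R_def by (rule exI, (rule derivative_eq_intros cdf_has_derivative assms refl)+)
  then obtain l where l: "(R has_real_derivative l) (at ?P)" ..
  \<comment> \<open>The radius \<open>?P\<close> keeps the neighbourhood inside the nonnegative
    prices, where the maximum is known.\<close>
  moreover have "l = 0"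
    by (rule DERIV_local_max[OF l, of "?P"])
      (use P a_nonneg in \<open>auto intro!: R_le_monopoly\<close>)
  ultimately show ?thesis by simp
qed

text \<open>For \<open>c\<close> below the monopoly price, the chord between them has positive slope
  \<open>s\<close> and \<open>R\<close> stays below it. The left difference quotients at that price
  are then at least \<open>s\<close>, against derivative 0.\<close>

lemma monopoly_le_if_convex:
  assumes sqc: "strictly_quasiconcave_on {a..b} R" and P: "monopoly_price M \<in> {a<..<b}"
    and deriv: "(R has_real_derivative 0) (at (monopoly_price M))"
    and "0 \<le> c" and conv: "convex_on {c..monopoly_price M} R"
  shows "monopoly_price M \<le> c"
proof (rule ccontr)
  let ?P = "monopoly_price M"
  assume "\<not> ?P \<le> c"
  then have "c < ?P" by simp
  define s where "s = (R ?P - R c) / (?P - c)"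
  have "s > 0"
    using R_less_monopoly[OF sqc P \<open>0 \<le> c\<close> \<open>c < ?P\<close>] \<open>c < ?P\<close> by (simp add: s_def)
  \<comment> \<open>Half the slope leaves room: a short step \<open>h\<close> to the left costs less
    than \<open>s / 2 * h\<close> by the derivative, but at least \<open>s * h\<close> by the
    chord.\<close>
  have "((\<lambda>m. R m - s / 2 * m) has_real_derivative - (s / 2)) (at ?P)"
    by (rule derivative_eq_intros deriv refl | simp)+
  from DERIV_neg_dec_left[OF this] \<open>s > 0\<close> obtain d where "d > 0"
    and d: "\<And>h. 0 < h \<Longrightarrow> h < d \<Longrightarrow> R ?P - s / 2 * ?P < R (?P - h) - s / 2 * (?P - h)"
    by auto
  define h where "h = min (d / 2) (?P - c)"
  have h: "0 < h" "h < d" "h \<le> ?P - c"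
    using \<open>d > 0\<close> \<open>c < ?P\<close> by (auto simp: h_def)
  define t where "t = h / (?P - c)"
  have t: "0 \<le> t" "t \<le> 1" "t * (?P - c) = h"
    using h \<open>c < ?P\<close> by (auto simp: t_def)
  have "R ((1 - t) *\<^sub>R ?P + t *\<^sub>R c) \<le> (1 - t) * R ?P + t * R c"
    by (rule convex_onD[OF conv]) (use t \<open>c < ?P\<close> in auto)
  moreover have "(1 - t) *\<^sub>R ?P + t *\<^sub>R c = ?P - h"
    using t(3) by (simp add: algebra_simps)
  moreover have "(1 - t) * R ?P + t * R c = R ?P - t * (R ?P - R c)"
    by (simp add: algebra_simps)
  moreover have "t * (R ?P - R c) = s * h"
    by (simp add: t_def s_def)
  ultimately have "R (?P - h) \<le> R ?P - s * h" by simp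
  moreover have "s / 2 * (?P - h) = s / 2 * ?P - s * h / 2"
    by (simp add: algebra_simps diff_divide_distrib)
  ultimately have "s * h < s * h / 2"
    using d[OF h(1,2)] by linarith
  moreover have "0 < s * h" using \<open>s > 0\<close> h(1) by simp
  ultimately show False by linarith
qed

end

section \<open>Types for which a given pair is a best choice\<close>

text \<open>Under \<open>p 0 = q 0 = 0\<close>, index 0 stands for not buying, so the comparison
  with it is the participation constraint.\<close>

definition best_types :: "nat \<Rightarrow> (nat \<Rightarrow> real) \<Rightarrow> (nat \<Rightarrow> real) \<Rightarrow> nat \<Rightarrow> real set" where
  "best_types n p q i = {m. \<forall>j\<le>n. m * q j - p j \<le> m * q i - p i}"

lemma best_types_eq_Max:
  assumes "p 0 = 0" "q 0 = 0" "i \<in> {1..n}"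
  shows "m \<in> best_types n p q i \<longleftrightarrow> 0 \<le> m * q i - p i \<and>
    m * q i - p i = Max ((\<lambda>(p', q'). m * q' - p') ` (\<lambda>i. (p i, q i)) ` {1..n})"
proof -
  have "m * q i - p i = Max ((\<lambda>j. m * q j - p j) ` {1..n}) \<longleftrightarrow>
      (\<forall>j\<in>{1..n}. m * q j - p j \<le> m * q i - p i)"
    by (subst eq_Max_iff) (use assms(3) in auto)
  moreover have "{..n} = insert 0 {1..n}"
    by auto
  then have "(\<forall>j\<le>n. m * q j - p j \<le> m * q i - p i) \<longleftrightarrow>
      0 \<le> m * q i - p i \<and> (\<forall>j\<in>{1..n}. m * q j - p j \<le> m * q i - p i)"
    using assms(1,2) unfolding atMost_iff[symmetric] Ball_def[symmetric] by simp
  ultimately show ?thesis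
    by (simp add: best_types_def image_image)
qed

lemma closed_best_types: "closed (best_types n p q i)"
proof -
  have "best_types n p q i = (\<Inter>j\<in>{..n}. {m. m * q j - p j \<le> m * q i - p i})"
    by (auto simp: best_types_def)
  also have "closed \<dots>"
    by (intro closed_INT ballI closed_Collect_le continuous_intros)
  finally show ?thesis .
qed

lemma (in type_distribution) demand_eq_measure:
  assumes "p 0 = 0" "q 0 = 0" "i \<in> {1..n}"
  shows "demand M a b ((\<lambda>i. (p i, q i)) ` {1..n}) (p i, q i) =
    measure M ({a..b} \<inter> best_types n p q i)"
proof -
  have [measurable]: "best_types n p q i \<in> sets borel"
    by (rule borel_closed[OF closed_best_types])
  have "demand M a b ((\<lambda>i. (p i, q i)) ` {1..n}) (p i, q i) =
      (LINT m|M. indicator ({a..b} \<inter> best_types n p q i) m)"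
    unfolding demand_def set_lebesgue_integral_def prod.case
    by (intro Bochner_Integration.integral_cong refl)
      (auto simp: best_types_eq_Max[where p = p and q = q, OF assms] split: split_indicator)
  also have "\<dots> = measure M ({a..b} \<inter> best_types n p q i)"
    by simp
  finally show ?thesis .
qed

section \<open>Order of the cutoffs\<close>

context
  fixes n :: nat and p q :: "nat \<Rightarrow> real"
  assumes zero: "p 0 = 0" "q 0 = 0"
    and p_mono: "strict_mono_on {1..n} p"
    and q_pos: "\<And>i. i \<in> {1..n} \<Longrightarrow> 0 < q i"
    and best: "\<And>i. i \<in> {1..n} \<Longrightarrow> \<exists>m\<ge>0. m \<in> best_types n p q i"
begin

text \<open>Some nonnegative type weakly prefers the dearer of two neighbouring pairs, so that pair
  must offer more quality.\<close>

lemma quality_less: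
  assumes "i < n"
  shows "q i < q (Suc i)"
\<comment> \<open>The strict price order starts at index 1 and \<open>p 1 = 0\<close> is possible,
  so the first step rests on positive quality instead.\<close>
proof (cases "i = 0")
  case True
  then show ?thesis using zero q_pos[of 1] assms by simp
next
  case False
  obtain m where m: "m \<ge> 0" "m \<in> best_types n p q (Suc i)"
    using best[of "Suc i"] assms by auto
  have "p i < p (Suc i)"
    by (rule strict_mono_onD[OF p_mono]) (use False assms in auto)
  moreover have "m * q i - p i \<le> m * q (Suc i) - p (Suc i)"
    using m(2) assms by (simp add: best_types_def)
  ultimately have "0 < m * (q (Suc i) - q i)"
    by (simp add: algebra_simps)
  then show ?thesis
    using m(1) by (simp add: zero_less_mult_iff)
qed

text \<open>A cutoff is the type that is indifferent between two neighbouring pairs.\<close>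

lemma cutoff_le_iff:
  assumes "i < n"
  shows "cutoff p q (Suc i) \<le> m \<longleftrightarrow> m * q i - p i \<le> m * q (Suc i) - p (Suc i)"
    and "m \<le> cutoff p q (Suc i) \<longleftrightarrow> m * q (Suc i) - p (Suc i) \<le> m * q i - p i"
  using quality_less[OF assms] by (auto simp: cutoff_def field_simps)

text \<open>Any type for which pair \<open>k\<close> is best lies between the cutoffs of
  \<open>k\<close> and \<open>Suc k\<close>.\<close>

lemma cutoff_mono:
  assumes "1 \<le> i" "i \<le> j" "j \<le> n"
  shows "cutoff p q i \<le> cutoff p q j"
  using assms(2,3)
proof (induction j rule: dec_induct)
  case (step k)
  obtain m where m: "m \<in> best_types n p q k"
    using best[of k] assms(1) step by auto
  obtain k' where k': "k = Suc k'"
    using assms(1) step by (cases k) auto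
  have "cutoff p q k \<le> m"
    using m step k' by (auto simp: cutoff_le_iff best_types_def)
  moreover have "m \<le> cutoff p q (Suc k)"
    using m step by (auto simp: cutoff_le_iff best_types_def)
  ultimately show ?case using step by simp
qed simp

text \<open>Beating the neighbours suffices: the cutoffs are ordered, so comparisons of neighbours
  chain to a comparison with every \<open>j\<close>.\<close>

lemma best_types_eq_interval:
  assumes i: "i \<in> {1..n}"
  shows "best_types n p q i =
    (if i = n then {cutoff p q n..} else {cutoff p q i..cutoff p q (Suc i)})"
proof -
  obtain i' where i': "i = Suc i'"
    using i by (cases i) auto
  have "m \<in> best_types n p q i \<longleftrightarrow>
      m \<in> (if i = n then {cutoff p q n..} else {cutoff p q i..cutoff p q (Suc i)})"
    (is "_ \<longleftrightarrow> ?R m") for m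
  proof
    assume "m \<in> best_types n p q i"
    then show "?R m"
      using i i' by (auto simp: cutoff_le_iff best_types_def)
  next
    assume "?R m"
    then have R: "cutoff p q i \<le> m" "i < n \<Longrightarrow> m \<le> cutoff p q (Suc i)"
      by (auto split: if_splits)
    have "m * q j - p j \<le> m * q i - p i" if "j \<le> n" for j
    proof (cases "j \<le> i")
      case True
      \<comment> \<open>Descending from \<open>i\<close>, every cutoff passed is at most
        \<open>m\<close>, so no step down raises utility. The other case climbs from
        \<open>i\<close> in the same way.\<close>
      then show ?thesis
      proof (induction j rule: inc_induct)
        case (step k)
        have "cutoff p q (Suc k) \<le> m"
          using cutoff_mono[of "Suc k" i] i R step by auto
        then show ?case
          using step i by (simp add: cutoff_le_iff)
      qed simp
    next
      case False
      then have "i \<le> j" by simp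
      then show ?thesis
        using that
      proof (induction j rule: dec_induct)
        case (step k)
        have "m \<le> cutoff p q (Suc k)"
          using cutoff_mono[of "Suc i" "Suc k"] R step by auto
        then show ?case
          using step by (simp add: cutoff_le_iff)
      qed simp
    qed
    then show "m \<in> best_types n p q i" by (simp add: best_types_def)
  qed
  then show ?thesis by (intro set_eqI)
qed

section \<open>Quality steps as weights on the cutoffs\<close>

lemma sum_quality_steps: "(\<Sum>i=1..n. q i - q (i - 1)) = q n"
  using sum_telescope''[of 0 n q] zero by (simp add: atLeastSucAtMost_greaterThanAtMost)

lemma quality_step_pos: "i \<in> {1..n} \<Longrightarrow> 0 < q i - q (i - 1)"
  using quality_less[of "i - 1"] by auto

lemma sum_cutoff: "(\<Sum>i=1..n. (q i - q (i - 1)) * cutoff p q i) = p n"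
proof -
  have "(\<Sum>i=1..n. (q i - q (i - 1)) * cutoff p q i) = (\<Sum>i=1..n. p i - p (i - 1))"
    by (intro sum.cong refl) (use quality_step_pos in \<open>force simp: cutoff_def\<close>)
  also have "\<dots> = p n"
    using sum_telescope''[of 0 n p] zero by (simp add: atLeastSucAtMost_greaterThanAtMost)
  finally show ?thesis .
qed

text \<open>Divided by \<open>q n\<close>, the quality steps are weights of total 1, and the cutoffs
  have mean \<open>p n / q n\<close> under them. The function is generic so that both
  \<open>R\<close> and its negative can be inserted.\<close>

lemma cutoff_jensen:
  assumes "1 \<le> n" and conv: "convex_on {cutoff p q 1..cutoff p q n} h"
  shows "q n * h (p n / q n) \<le> (\<Sum>i=1..n. (q i - q (i - 1)) * h (cutoff p q i))"
proof -
  let ?w = "\<lambda>i. (q i - q (i - 1)) / q n"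
  have qn: "0 < q n" using q_pos[of n] assms(1) by simp
  have "h (\<Sum>i\<in>{1..n}. ?w i *\<^sub>R cutoff p q i) \<le> (\<Sum>i\<in>{1..n}. ?w i * h (cutoff p q i))"
  proof (rule convex_on_sum[OF _ _ conv])
    show "(\<Sum>i\<in>{1..n}. ?w i) = 1"
      using sum_quality_steps qn by (simp add: sum_divide_distrib[symmetric])
    show "0 \<le> ?w i" if "i \<in> {1..n}" for i
      using quality_step_pos[OF that] qn by simp
    show "cutoff p q i \<in> {cutoff p q 1..cutoff p q n}" if "i \<in> {1..n}" for i
      using cutoff_mono[of 1 i] cutoff_mono[of i n] that by auto
  qed (use assms(1) in auto)
  also have "(\<Sum>i\<in>{1..n}. ?w i *\<^sub>R cutoff p q i) = p n / q n"
    using sum_cutoff by (simp add: sum_divide_distrib[symmetric])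
  also have "(\<Sum>i\<in>{1..n}. ?w i * h (cutoff p q i)) =
      (\<Sum>i=1..n. (q i - q (i - 1)) * h (cutoff p q i)) / q n"
    by (simp add: sum_divide_distrib)
  finally show ?thesis
    using qn by (simp add: field_simps)
qed

lemma cutoff_1_le_average: "1 \<le> n \<Longrightarrow> cutoff p q 1 \<le> p n / q n"
proof -
  assume "1 \<le> n"
  have "cutoff p q 1 * q n = (\<Sum>i=1..n. (q i - q (i - 1)) * cutoff p q 1)"
    by (simp only: sum_distrib_right[symmetric] sum_quality_steps) (rule mult.commute)
  also have "\<dots> \<le> (\<Sum>i=1..n. (q i - q (i - 1)) * cutoff p q i)"
    by (intro sum_mono mult_left_mono cutoff_mono) (use quality_step_pos in force)+
  finally show ?thesis
    using q_pos[of n] \<open>1 \<le> n\<close> sum_cutoff by (simp add: field_simps)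
qed

end

section \<open>Revenue as a weighted sum over cutoffs\<close>

text \<open>The boundary term lets the identity hold at every \<open>n\<close> for one fixed
  \<open>g\<close>, as the induction requires.\<close>

lemma sum_by_parts_nat:
  fixes p g :: "nat \<Rightarrow> real"
  assumes "p 0 = 0"
  shows "(\<Sum>i=1..n. p i * (g i - g (Suc i))) + p n * g (Suc n) = (\<Sum>i=1..n. (p i - p (i - 1)) * g i)"
proof (induction n)
  case 0
  then show ?case using assms by simp
next
  case (Suc n)
  then show ?case by (simp add: left_diff_distrib right_diff_distrib)
qed

text \<open>Turns positive demand into the assumption \<open>best\<close>: an empty set of buyers
  would have measure zero.\<close>

lemma (in type_distribution) best_types_nonempty:
  assumes "p 0 = 0" "q 0 = 0" "i \<in> {1..n}"
    and "0 < demand M a b ((\<lambda>i. (p i, q i)) ` {1..n}) (p i, q i)"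
  shows "\<exists>m\<ge>0. m \<in> best_types n p q i"
proof -
  have "{a..b} \<inter> best_types n p q i \<noteq> {}"
  proof
    assume "{a..b} \<inter> best_types n p q i = {}"
    then show False using demand_eq_measure[where p = p and q = q, OF assms(1-3)] assms(4) by simp
  qed
  then show ?thesis using a_nonneg by force
qed

lemma (in type_distribution) revenue_eq_sum_cutoff:
  assumes zero: "p 0 = 0" "q 0 = 0"
    and p_mono: "strict_mono_on {1..n} p"
    and q_pos: "\<And>i. i \<in> {1..n} \<Longrightarrow> 0 < q i"
    and demand: "\<And>i. i \<in> {1..n} \<Longrightarrow> 0 < demand M a b ((\<lambda>i. (p i, q i)) ` {1..n}) (p i, q i)"
  shows "revenue M a b ((\<lambda>i. (p i, q i)) ` {1..n}) =
    (\<Sum>i=1..n. (q i - q (i - 1)) * R (cutoff p q i))"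
proof -
  have best: "\<exists>m\<ge>0. m \<in> best_types n p q i" if "i \<in> {1..n}" for i
    using best_types_nonempty[OF zero that demand[OF that]] .
  note menu = zero p_mono q_pos best
  \<comment> \<open>For \<open>i\<close> in \<open>{1..n}\<close> this is the share of types that
    buy pair \<open>i\<close> or a dearer one. The value 0 beyond \<open>n\<close> gives the top
    pair's demand the same form and removes the boundary term.\<close>
  define g where "g i = (if i \<le> n then 1 - cdf M (cutoff p q i) else 0)" for i
  \<comment> \<open>Revenue sums over a set of pairs; distinct prices permit summing over
    indices.\<close>
  have inj: "inj_on (\<lambda>i. (p i, q i)) {1..n}"
    by (rule inj_onI) (use strict_mono_on_imp_inj_on[OF p_mono] in \<open>blast dest: inj_onD\<close>)
  have D: "demand M a b ((\<lambda>i. (p i, q i)) ` {1..n}) (p i, q i) = g i - g (Suc i)"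
    if i: "i \<in> {1..n}" for i
  proof -
    have "demand M a b ((\<lambda>i. (p i, q i)) ` {1..n}) (p i, q i) = measure M (best_types n p q i)"
      using demand_eq_measure[where p = p and q = q, OF zero i] measure_Int_support
        borel_closed[OF closed_best_types]
      by simp
    also have "\<dots> = g i - g (Suc i)"
    proof (cases "i = n")
      case True
      then show ?thesis
        using best_types_eq_interval[OF menu i] by (simp add: g_def measure_atLeast)
    next
      case False
      then have "cutoff p q i \<le> cutoff p q (Suc i)"
        using cutoff_mono[OF menu, of i "Suc i"] i by simp
      then show ?thesis
        using best_types_eq_interval[OF menu i] False i
        by (simp add: g_def measure_atLeastAtMost)
    qed
    finally show ?thesis .
  qed
  have "revenue M a b ((\<lambda>i. (p i, q i)) ` {1..n}) = (\<Sum>i=1..n. p i * (g i - g (Suc i)))"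
    unfolding revenue_def sum.reindex[OF inj] o_def prod.case
    by (intro sum.cong refl) (simp only: D)
  also have "\<dots> = (\<Sum>i=1..n. (p i - p (i - 1)) * g i)"
    using sum_by_parts_nat[where p = p, OF zero(1), of g n] by (simp add: g_def)
  also have "\<dots> = (\<Sum>i=1..n. (q i - q (i - 1)) * R (cutoff p q i))"
  proof (rule sum.cong[OF refl])
    fix i assume i: "i \<in> {1..n}"
    have "q i - q (i - 1) \<noteq> 0" using quality_step_pos[OF menu i] by simp
    then have "(q i - q (i - 1)) * cutoff p q i = p i - p (i - 1)"
      by (simp add: cutoff_def)
    moreover have "(q i - q (i - 1)) * R (cutoff p q i) = (q i - q (i - 1)) * cutoff p q i * g i"
      using i by (simp add: g_def R_def mult.assoc)
    ultimately show "(p i - p (i - 1)) * g i = (q i - q (i - 1)) * R (cutoff p q i)"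
      by simp
  qed
  finally show ?thesis .
qed

lemma (in type_distribution) revenue_singleton:
  assumes "0 < y" and "0 < demand M a b {(x, y)} (x, y)"
  shows "revenue M a b {(x, y)} = y * R (x / y)"
proof -
  \<comment> \<open>A single pair is the case \<open>n = 1\<close> with not buying at index 0; its
    only cutoff is \<open>x / y\<close>.\<close>
  let ?p = "\<lambda>i::nat. if i = 0 then 0 else x" and ?q = "\<lambda>i::nat. if i = 0 then 0 else y"
  have *: "(\<lambda>i. (?p i, ?q i)) ` {1..1} = {(x, y)}" by simp
  have "revenue M a b ((\<lambda>i. (?p i, ?q i)) ` {1..1}) =
      (\<Sum>i=1..1. (?q i - ?q (i - 1)) * R (cutoff ?p ?q i))"
  proof (rule revenue_eq_sum_cutoff)
    show "0 < demand M a b ((\<lambda>i. (?p i, ?q i)) ` {1..1}) (?p i, ?q i)" if "i \<in> {1..1}" for i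
      using assms that unfolding * by simp
  qed (use assms in \<open>auto simp: strict_mono_on_def\<close>)
  then show ?thesis
    unfolding * by (simp add: cutoff_def)
qed

section \<open>Comparison of the two revenues\<close>

theorem proposition2:
  fixes M :: "real measure" and f :: "real \<Rightarrow> real" and a b :: real
    and n :: nat and p q :: "nat \<Rightarrow> real" and C C' :: "(real \<times> real) set" and p' :: real
  assumes "0 \<le> a" and "a < b"
    and "real_distribution M"
    and "continuous_on UNIV (cdf M)"
    and "cdf M a = 0" and "cdf M b = 1"
    and "strict_mono_on {a..b} (cdf M)"
    and "f \<in> borel_measurable borel" and "\<And>m. 0 \<le> f m"
    and "M = density lborel (\<lambda>m. ennreal (f m))"
    and "continuous_on {a..b} f"
    and "1 \<le> n"
    and "p 0 = 0" and "q 0 = 0"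
    and "strict_mono_on {1..n} p"
    and "C = (\<lambda>i. (p i, q i)) ` {1..n}"
    and "is_menu C"
    and "\<And>x. x \<in> C \<Longrightarrow> 0 < demand M a b C x"
    and "C' = {(p', q n)}"
    and "is_menu C'"
    and "0 < demand M a b C' (p', q n)"
    and "p n \<le> p'"
    and "strictly_quasiconcave_on {a..b} (\<lambda>m. m * (1 - cdf M m))"
    and "monopoly_price M \<in> {a<..<b}"
  shows
    "(p' / q n \<le> monopoly_price M \<and>
      convex_on {cutoff p q 1..cutoff p q n} (\<lambda>m. cdf M m * m) \<longrightarrow>
        revenue M a b C \<le> revenue M a b C') \<and>
     (monopoly_price M \<le> cutoff p q n \<and>
      concave_on {cutoff p q 1..cutoff p q n} (\<lambda>m. cdf M m * m) \<longrightarrow>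
        revenue M a b C' \<le> revenue M a b C)"
proof -
  interpret real_distribution M by fact
  interpret type_distribution M a b
    by unfold_locales (use assms(1-6) in auto)
  let ?P = "monopoly_price M" and ?c = "cutoff p q"
  note C = \<open>C = (\<lambda>i. (p i, q i)) ` {1..n}\<close> and C' = \<open>C' = {(p', q n)}\<close>
  have zero: "p 0 = 0" "q 0 = 0" and p_mono: "strict_mono_on {1..n} p" and n: "1 \<le> n"
    by fact+
  have pq: "0 \<le> p i" "0 < q i" if "i \<in> {1..n}" for i
    using \<open>is_menu C\<close> that by (auto simp: is_menu_def C)
  have demand: "0 < demand M a b ((\<lambda>i. (p i, q i)) ` {1..n}) (p i, q i)" if "i \<in> {1..n}" for i
    using assms(18)[of "(p i, q i)"] that C by auto
  note menu = zero p_mono pq(2) best_types_nonempty[OF zero _ demand]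
  have qn: "0 < q n" and pn: "0 \<le> p n" using pq[of n] n by auto
  have rev_C: "revenue M a b C = (\<Sum>i=1..n. (q i - q (i - 1)) * R (?c i))"
    unfolding C by (rule revenue_eq_sum_cutoff[OF zero p_mono pq(2) demand])
  have rev_C': "revenue M a b C' = q n * R (p' / q n)"
    using revenue_singleton[OF qn] assms(21) unfolding C' by simp
  have le: "p n / q n \<le> p' / q n"
    using \<open>p n \<le> p'\<close> qn by (simp add: divide_right_mono)
  \<comment> \<open>Subtraction from a linear function exchanges convexity and concavity.\<close>
  have R_eq: "R = (\<lambda>m. m - cdf M m * m)"
    by (auto simp: R_def algebra_simps)
  have sqc: "strictly_quasiconcave_on {a..b} R"
    using assms(23) by (simp add: R_def[abs_def])
  have P: "?P \<in> {a<..<b}" by fact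
  show ?thesis
  proof (intro conjI impI; elim conjE)
    assume "p' / q n \<le> ?P" and conv: "convex_on {?c 1..?c n} (\<lambda>m. cdf M m * m)"
    then have "concave_on {?c 1..?c n} R"
      unfolding R_eq by (intro concave_on_diff) (auto simp: concave_on_ident)
    then have "convex_on {?c 1..?c n} (\<lambda>m. - R m)"
      by (simp add: concave_on_def)
    from cutoff_jensen[OF menu n this] have "revenue M a b C \<le> q n * R (p n / q n)"
      by (simp add: rev_C sum_negf)
    \<comment> \<open>Both prices per unit of quality are at most \<open>?P\<close>, where
      \<open>R\<close> is increasing.\<close>
    also have "\<dots> \<le> q n * R (p' / q n)"
      using R_mono[OF sqc P _ le] \<open>p' / q n \<le> ?P\<close> qn pn by simp
    finally show "revenue M a b C \<le> revenue M a b C'"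
      by (simp add: rev_C')
  next
    assume "?P \<le> ?c n" and conc: "concave_on {?c 1..?c n} (\<lambda>m. cdf M m * m)"
    then have conv: "convex_on {?c 1..?c n} R"
      unfolding R_eq by (intro convex_on_diff) (auto simp: convex_on_ident)
    have "?P \<le> ?c 1"
    proof (rule monopoly_le_if_convex[OF sqc P])
      show "(R has_real_derivative 0) (at ?P)"
        by (rule R_has_derivative_0_monopoly[OF assms(10,8,9,11) P])
      show "0 \<le> ?c 1"
        using pq[of 1] n zero by (simp add: cutoff_def)
      \<comment> \<open>The bound \<open>?P \<le> ?c n\<close> places this interval inside the one
        on which \<open>R\<close> is convex.\<close>
      show "convex_on {?c 1..?P} R"
        by (rule convex_on_subset[OF conv]) (use \<open>?P \<le> ?c n\<close> in auto)
    qed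
    also have "?c 1 \<le> p n / q n"
      by (rule cutoff_1_le_average[OF menu n])
    \<comment> \<open>Both prices per unit of quality are now at least \<open>?P\<close>, where
      \<open>R\<close> is decreasing.\<close>
    finally have "R (p' / q n) \<le> R (p n / q n)"
      by (rule R_antimono[OF sqc P _ le])
    then have "revenue M a b C' \<le> q n * R (p n / q n)"
      using qn by (simp add: rev_C')
    also have "\<dots> \<le> revenue M a b C"
      using cutoff_jensen[OF menu n conv] by (simp add: rev_C)
    finally show "revenue M a b C' \<le> revenue M a b C" .
  qed
qed

end
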